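(* Let $n\ge 3$ and let $T$ be a triangulation of a convex $n$-gon such that $|\mathrm{I}(T)|=0$, i.e. $T$ has no interior triangles. Then the number $\mathrm{s}(T)$ of satisfying states of $T$ is $$\mathrm{s}(T)=2F_{n+1},$$ where $F_k$ denotes the $k$-th Fibonacci number.
   Context: Let $C_n$ be a convex $n$-gon ($n\ge 3$), viewed as a cycle with $n$ vertices and $n$ edges. A triangulation of $C_n$ is a plane graph obtained from $C_n$ by adding $n-3$ new edges (pairwise non-crossing diagonals) so that $C_n$ is the boundary of its outer face; all its $n-2$ inner faces are triangles. An interior triangle of $T$ is an inner face of $T$ none of whose edges belongs to the boundary $C_n$; $\mathrm{I}(T)$ is the set of interior triangles of $T$. A state of $T$ is a function $\sigma:V(T)\to\{1,-1\}$. A state $\sigma$ frustrates an edge $\{u,v\}$ if $\sigma(u)=\sigma(v)$. A state is satisfying if it frustrates exactly one edge of each triangular inner face of $T$. $\mathrm{s}(T)$ is the number of satisfying states of $T$. Fibonacci numbers: $F_0=0$, $F_1=1$, $F_{k+1}=F_k+F_{k-1}$. *)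

theory Defs
  imports Complex_Main "HOL-Library.FuncSet" "HOL-Combinatorics.Orbits" "HOL-Number_Theory.Fib"
begin

text \<open>
  The vertices of the convex \<open>n\<close>-gon are \<open>0, \<dots>, n - 1\<close>, numbered counterclockwise along its
  boundary. A plane graph drawn with straight edges on these points is given by its set of edges,
  each edge being a two-element set of vertices.
\<close>

definition polygon_edges :: "nat \<Rightarrow> nat set set" where
  "polygon_edges n = {{i, Suc i mod n} | i. i < n}"

definition diagonals :: "nat \<Rightarrow> nat set set" where
  "diagonals n = {{i, j} | i j. i < n \<and> j < n \<and> i \<noteq> j} - polygon_edges n"

text \<open>
  Two chords of a convex polygon meet in their relative interiors, without being equal, iff
  their four end points are distinct and alternate along the boundary.
\<close>

definition crossing :: "nat set \<Rightarrow> nat set \<Rightarrow> bool" where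
  "crossing e f \<longleftrightarrow> (\<exists>a b c d. a < b \<and> b < c \<and> c < d \<and> {e, f} = {{a, c}, {b, d}})"

definition triangulation :: "nat \<Rightarrow> nat set set \<Rightarrow> bool" where
  "triangulation n T \<longleftrightarrow>
     (\<exists>D \<subseteq> diagonals n. card D = n - 3 \<and> (\<forall>e\<in>D. \<forall>f\<in>D. \<not> crossing e f) \<and>
        T = polygon_edges n \<union> D)"

definition darts :: "nat set set \<Rightarrow> (nat \<times> nat) set" where
  "darts T = {(u, v). u \<noteq> v \<and> {u, v} \<in> T}"

text \<open>
  Faces are obtained by face tracing, as orbits of darts. Around a vertex \<open>v\<close> the neighbours of
  \<open>v\<close> appear in the counterclockwise order \<open>v + 1, v + 2, \<dots>, v - 1\<close> (modulo \<open>n\<close>). Walking along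
  the dart \<open>(u, v)\<close> with a face on the left-hand side, the walk continues at \<open>v\<close> to the
  neighbour next to \<open>u\<close> in clockwise direction, which is the neighbour \<open>w \<noteq> u\<close> with the least
  cyclic distance \<open>u - w\<close> modulo \<open>n\<close>.
\<close>

definition face_step :: "nat \<Rightarrow> nat set set \<Rightarrow> nat \<times> nat \<Rightarrow> nat \<times> nat" where
  "face_step n T = (\<lambda>(u, v). (v, ARG_MIN (\<lambda>w. (u + n - w) mod n) w. w \<noteq> u \<and> {v, w} \<in> T))"

definition faces :: "nat \<Rightarrow> nat set set \<Rightarrow> (nat \<times> nat) set set" where
  "faces n T = orbit (face_step n T) ` darts T"

text \<open>
  The outer face lies to the left of the boundary cycle when that is traversed clockwise.
\<close>

definition outer_face :: "nat \<Rightarrow> (nat \<times> nat) set" where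
  "outer_face n = {(Suc i mod n, i) | i. i < n}"

definition inner_faces :: "nat \<Rightarrow> nat set set \<Rightarrow> (nat \<times> nat) set set" where
  "inner_faces n T = faces n T - {outer_face n}"

definition face_edges :: "(nat \<times> nat) set \<Rightarrow> nat set set" where
  "face_edges F = (\<lambda>(u, v). {u, v}) ` F"

definition interior_triangles :: "nat \<Rightarrow> nat set set \<Rightarrow> (nat \<times> nat) set set" where
  "interior_triangles n T = {F \<in> inner_faces n T. face_edges F \<inter> polygon_edges n = {}}"

definition states :: "nat \<Rightarrow> (nat \<Rightarrow> int) set" where
  "states n = {..<n} \<rightarrow>\<^sub>E {1, -1}"

definition frustrates :: "(nat \<Rightarrow> int) \<Rightarrow> nat set \<Rightarrow> bool" where
  "frustrates \<sigma> e \<longleftrightarrow> (\<exists>u v. e = {u, v} \<and> u \<noteq> v \<and> \<sigma> u = \<sigma> v)"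

definition satisfying :: "nat \<Rightarrow> nat set set \<Rightarrow> (nat \<Rightarrow> int) \<Rightarrow> bool" where
  "satisfying n T \<sigma> \<longleftrightarrow>
     (\<forall>F \<in> inner_faces n T. card F = 3 \<longrightarrow> card {e \<in> face_edges F. frustrates \<sigma> e} = 1)"

definition num_satisfying :: "nat \<Rightarrow> nat set set \<Rightarrow> nat" where
  "num_satisfying n T = card {\<sigma> \<in> states n. satisfying n T \<sigma>}"

end

theory Submission
  imports Defs
begin

text \<open>
  Cut open along the edge \<open>{0, n - 1}\<close>, a triangulation of the polygon becomes a
  recursive subdivision of the interval \<open>[0, n - 1]\<close>. If \<open>{i, j}\<close> is an edge with \<open>i + 2 \<le> j\<close>, there is
  an apex \<open>k\<close> strictly between \<open>i\<close> and \<open>j\<close> such that \<open>{i, k}\<close> and \<open>{k, j}\<close> are edges as well, and every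
  other edge inside \<open>[i, j]\<close> lies inside \<open>[i, k]\<close> or inside \<open>[k, j]\<close>. The apex comes from counting:
  noncrossing chords inside \<open>[i, j]\<close> number at most \<open>2 (j - i) - 1\<close>, and the \<open>n + (n - 3)\<close> edges of a
  triangulation attain this bound on \<open>[0, n - 1]\<close>, hence on every interval that occurs in the
  subdivision. Face tracing then identifies the inner faces with the triples of mutually adjacent
  vertices (\<open>inner_faces_eq\<close>), so a state is satisfying iff no such triple is
  monochromatic (\<open>satisfying_iff\<close>).

  Fix the values \<open>x\<close> and \<open>y\<close> of a state at \<open>i\<close> and \<open>j\<close>, and let \<open>A\<close> and \<open>B\<close> be the numbers of
  admissible states on \<open>[i, j]\<close> for \<open>x = y\<close> and for \<open>x \<noteq> y\<close>. If the apex \<open>k\<close> splits \<open>[i, j]\<close> into parts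
  with numbers \<open>A', B'\<close> and \<open>A'', B''\<close>, summing over the value at \<open>k\<close> gives
  \<open>A = B' B''\<close> and \<open>B = A' B'' + B' A''\<close> (\<open>card_proper_states_glue\<close>). An interval of length \<open>1\<close> has
  \<open>A = B = 1\<close>. Without interior triangles, the triangle below an edge other than \<open>{0, n - 1}\<close>
  has a polygon edge as one of its two remaining sides, so one part has length \<open>1\<close> and the
  recursion reduces to \<open>A = b\<close>, \<open>B = a + b\<close> with the numbers \<open>a\<close>, \<open>b\<close> of the other part, regardless of
  which of the two parts is the short one. Hence
  \<open>A = F\<^sub>m\<close> and \<open>B = F\<^sub>m\<^sub>+\<^sub>1\<close> for an interval of length \<open>m\<close> (\<open>card_proper_states\<close>).

  Only at the edge \<open>{0, n - 1}\<close>, itself a polygon edge, both parts may be long. If their lengths are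
  \<open>p\<close> and \<open>q\<close>, with \<open>p + q = n - 1\<close>, the total is
  \<open>2 (A + B) = 2 (F\<^sub>p\<^sub>+\<^sub>1 F\<^sub>q\<^sub>+\<^sub>1 + F\<^sub>p F\<^sub>q\<^sub>+\<^sub>1 + F\<^sub>p\<^sub>+\<^sub>1 F\<^sub>q)\<close>, which the addition formula for
  Fibonacci numbers turns into \<open>2 F\<^sub>p\<^sub>+\<^sub>q\<^sub>+\<^sub>2\<close>.
\<close>

section \<open>Saturated intervals of noncrossing chords\<close>

definition noncrossing :: "nat set set \<Rightarrow> bool" where
  "noncrossing T \<longleftrightarrow>
     (\<forall>a b c d. a < b \<longrightarrow> b < c \<longrightarrow> c < d \<longrightarrow> {a, c} \<in> T \<longrightarrow> {b, d} \<notin> T)"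

lemma noncrossingD:
  "noncrossing T \<Longrightarrow> {a, c} \<in> T \<Longrightarrow> {b, d} \<in> T \<Longrightarrow> a < b \<Longrightarrow> b < c \<Longrightarrow> c < d \<Longrightarrow> False"
  unfolding noncrossing_def by blast

definition chords :: "nat set set \<Rightarrow> nat \<Rightarrow> nat \<Rightarrow> (nat \<times> nat) set" where
  "chords T i j = {(a, b). i \<le> a \<and> a < b \<and> b \<le> j \<and> {a, b} \<in> T}"

lemma finite_chords [simp]: "finite (chords T i j)"
  by (rule finite_subset[of _ "{i..j} \<times> {i..j}"]) (auto simp: chords_def)

text \<open>
  The farthest neighbour \<open>k\<close> of \<open>i\<close> below \<open>j\<close> separates the interval: a chord that starts at \<open>i\<close>
  ends at \<open>k\<close> or earlier, or at \<open>j\<close>, and any other chord that passes over \<open>k\<close> crosses \<open>{i, k}\<close>.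
\<close>

lemma chords_split:
  assumes T: "noncrossing T" and "i + 2 \<le> j"
  obtains k where "i < k" "k < j" "chords T i j \<subseteq> insert (i, j) (chords T i k \<union> chords T k j)"
proof -
  \<comment> \<open>Including \<open>Suc i\<close> makes the set nonempty; no chord passes over \<open>Suc i\<close> unless it starts at \<open>i\<close>.\<close>
  define K where "K = insert (Suc i) {k. i < k \<and> k < j \<and> {i, k} \<in> T}"
  define k where "k = Max K"
  have fin: "finite K"
    by (rule finite_subset[of _ "{i..j}"]) (use assms(2) in \<open>auto simp: K_def\<close>)
  have "k \<in> K"
    unfolding k_def using fin by (rule Max_in) (simp add: K_def)
  have max: "\<And>l. l \<in> K \<Longrightarrow> l \<le> k"
    unfolding k_def using fin by (rule Max_ge)
  from \<open>k \<in> K\<close> have k: "i < k" "k < j" "k = Suc i \<or> {i, k} \<in> T"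
    using assms(2) by (auto simp: K_def)
  have "(a, b) = (i, j) \<or> b \<le> k \<or> k \<le> a" if ab: "(a, b) \<in> chords T i j" for a b
  proof (cases "a = i")
    case True
    then show ?thesis using ab max[of b] by (auto simp: chords_def K_def)
  next
    case False
    then show ?thesis using ab k noncrossingD[OF T, of i k a b] by (force simp: chords_def not_le)
  qed
  then have "chords T i j \<subseteq> insert (i, j) (chords T i k \<union> chords T k j)"
    by (force simp: chords_def)
  with k show ?thesis using that by blast
qed

text \<open>
  Splitting at \<open>k\<close> gives \<open>1 + (2 (k - i) - 1) + (2 (j - k) - 1) = 2 (j - i) - 1\<close>.
\<close>

lemma card_chords_le:
  assumes "noncrossing T" "i < j"
  shows "card (chords T i j) \<le> 2 * (j - i) - 1"
  using assms(2)
proof (induction "j - i" arbitrary: i j rule: less_induct)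
  case less
  show ?case
  proof (cases "j = Suc i")
    case True
    then have "chords T i j \<subseteq> {(i, j)}" by (auto simp: chords_def)
    from card_mono[OF _ this] True show ?thesis by simp
  next
    case False
    with less.prems obtain k where k: "i < k" "k < j"
      and sub: "chords T i j \<subseteq> insert (i, j) (chords T i k \<union> chords T k j)"
      using chords_split[OF assms(1), of i j] by auto
    have "card (chords T i j) \<le> card (insert (i, j) (chords T i k \<union> chords T k j))"
      using sub by (intro card_mono) auto
    also have "\<dots> \<le> Suc (card (chords T i k) + card (chords T k j))"
      by (intro order.trans[OF card_insert_le_m1] card_insert_le_m1) (auto simp: card_Un_le card_insert_if le_SucI)
    finally show ?thesis
      using less.hyps[of k i] less.hyps[of j k] k by force
  qed
qed

text \<open>
  The intervals whose chords attain the bound of \<open>card_chords_le\<close>, that is, the fully subdivided ones.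
\<close>

definition saturated :: "nat set set \<Rightarrow> nat \<Rightarrow> nat \<Rightarrow> bool" where
  "saturated T i j \<longleftrightarrow> i < j \<and> card (chords T i j) = 2 * (j - i) - 1"

lemma saturated_less: "saturated T i j \<Longrightarrow> i < j"
  by (simp add: saturated_def)

text \<open>
  The bound for \<open>[i, j]\<close> is exactly one more than the sum of the bounds for the two parts. When it is
  attained, the chord \<open>{i, j}\<close> must be present and both parts must attain their bounds.
\<close>

lemma saturated_split:
  assumes T: "noncrossing T" and sat: "saturated T i j" and "i + 2 \<le> j"
  obtains k where "{i, j} \<in> T" "saturated T i k" "saturated T k j"
    "chords T i j = insert (i, j) (chords T i k \<union> chords T k j)"
proof -
  obtain k where k: "i < k" "k < j"
    and sub: "chords T i j \<subseteq> insert (i, j) (chords T i k \<union> chords T k j)"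
    using chords_split[OF T \<open>i + 2 \<le> j\<close>] .
  have bound: "card (chords T i k) \<le> 2 * (k - i) - 1" "card (chords T k j) \<le> 2 * (j - k) - 1"
    using card_chords_le[OF T] k by auto
  have un: "card (chords T i k \<union> chords T k j) \<le> card (chords T i k) + card (chords T k j)"
    by (rule card_Un_le)
  have ij: "{i, j} \<in> T"
  proof (rule ccontr)
    assume "{i, j} \<notin> T"
    then have "chords T i j \<subseteq> chords T i k \<union> chords T k j"
      using sub by (auto simp: chords_def)
    then have "card (chords T i j) \<le> card (chords T i k \<union> chords T k j)"
      by (intro card_mono) auto
    with un bound k sat show False by (auto simp: saturated_def)
  qed
  then have eq: "chords T i j = insert (i, j) (chords T i k \<union> chords T k j)"
    using sub k by (fastforce simp: chords_def)
  have "card (chords T i j) \<le> Suc (card (chords T i k \<union> chords T k j))"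
    unfolding eq by (simp add: card_insert_if)
  with un bound k sat have "saturated T i k \<and> saturated T k j"
    unfolding saturated_def by linarith
  with ij eq show ?thesis using that by blast
qed

lemma saturated_edge:
  assumes "noncrossing T" "saturated T i j"
  shows "{i, j} \<in> T"
proof (cases "j = Suc i")
  case True
  with assms(2) have "chords T i j \<noteq> {}" by (auto simp: saturated_def)
  then obtain a b where "i \<le> a" "a < b" "b \<le> j" "{a, b} \<in> T" by (auto simp: chords_def)
  moreover from this True have "a = i" "b = j" by auto
  ultimately show ?thesis by simp
next
  case False
  with saturated_split[OF assms] saturated_less[OF assms(2)] show ?thesis
    by (metis Suc_leI add_2_eq_Suc' le_neq_implies_less)
qed

lemma saturated_induct [consumes 2, case_names side split]:
  assumes T: "noncrossing T" and "saturated T i j"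
    and side: "\<And>i. {i, Suc i} \<in> T \<Longrightarrow> P i (Suc i)"
    and split: "\<And>i j k. saturated T i j \<Longrightarrow> saturated T i k \<Longrightarrow> saturated T k j \<Longrightarrow>
      chords T i j = insert (i, j) (chords T i k \<union> chords T k j) \<Longrightarrow> P i k \<Longrightarrow> P k j \<Longrightarrow> P i j"
  shows "P i j"
  using assms(2)
proof (induction "j - i" arbitrary: i j rule: less_induct)
  case less
  show ?case
  proof (cases "j = Suc i")
    case True
    then show ?thesis using side saturated_edge[OF T less.prems] by simp
  next
    case False
    with saturated_less[OF less.prems] have "i + 2 \<le> j" by simp
    then obtain k where k: "saturated T i k" "saturated T k j"
      "chords T i j = insert (i, j) (chords T i k \<union> chords T k j)"
      using saturated_split[OF T less.prems] by blast
    moreover have "k - i < j - i" "j - k < j - i"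
      using k(1,2)[THEN saturated_less] by auto
    ultimately show ?thesis using split[OF less.prems] less.hyps by blast
  qed
qed

lemma saturated_chord:
  assumes "noncrossing T" "saturated T i j" "(a, b) \<in> chords T i j"
  shows "saturated T a b"
  using assms
proof (induction rule: saturated_induct)
  case (side i)
  then have "chords T i (Suc i) = {(i, Suc i)}" by (auto simp: chords_def)
  with side show ?case by (auto simp: saturated_def)
qed auto

section \<open>Triangles\<close>

text \<open>
  Mutual adjacency is all that is required. In a triangulation such triples turn out to be
  exactly the inner faces, since noncrossing edges leave no room for an edge into the triangle.
\<close>

definition triangle :: "nat set set \<Rightarrow> nat \<Rightarrow> nat \<Rightarrow> nat \<Rightarrow> bool" where
  "triangle T a b c \<longleftrightarrow> a < b \<and> b < c \<and> {a, b} \<in> T \<and> {b, c} \<in> T \<and> {a, c} \<in> T"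

lemma triangleI:
  "noncrossing T \<Longrightarrow> saturated T i k \<Longrightarrow> saturated T k j \<Longrightarrow> saturated T i j \<Longrightarrow> triangle T i k j"
  by (simp add: triangle_def saturated_edge saturated_less)

text \<open>
  Every edge lies on a triangle on its inner side, unless it joins consecutive vertices, and on
  a triangle on its outer side, unless it is the root of the subdivision. This and the following
  lemma provide the face to the left of each of the two darts of an edge.
\<close>

lemma triangle_below:
  assumes T: "noncrossing T" and "saturated T a b" "b \<noteq> Suc a"
  obtains k where "triangle T a k b"
proof -
  from assms(3) saturated_less[OF assms(2)] have "a + 2 \<le> b" by simp
  then show ?thesis using saturated_split[OF T assms(2)] triangleI[OF T] assms(2) that by metis
qed

lemma triangle_above:
  assumes "noncrossing T" "saturated T i j" "(a, b) \<in> chords T i j" "(a, b) \<noteq> (i, j)"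
  shows "\<exists>c. triangle T c a b \<or> triangle T a b c"
  using assms
proof (induction rule: saturated_induct)
  case (side i)
  then show ?case by (auto simp: chords_def)
next
  case (split i j k)
  show ?case
  proof (cases "(a, b) = (i, k) \<or> (a, b) = (k, j)")
    case True
    then show ?thesis using triangleI[OF assms(1) split.hyps(2,3,1)] by auto
  next
    case False
    then show ?thesis using split by auto
  qed
qed

text \<open>
  A triangle inside \<open>[i, j]\<close> other than \<open>(i, k, j)\<close> stays on one side of \<open>k\<close>. Otherwise its longest
  side crosses \<open>{i, k}\<close> or \<open>{k, j}\<close>, or it is \<open>{i, j}\<close> and another side crosses one of these two.
\<close>

lemma triangle_split:
  assumes T: "noncrossing T" and "triangle T i k j"
  shows "triangle T a b c \<and> i \<le> a \<and> c \<le> j \<longleftrightarrow>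
     (a, b, c) = (i, k, j) \<or> triangle T a b c \<and> (i \<le> a \<and> c \<le> k \<or> k \<le> a \<and> c \<le> j)" (is "?L \<longleftrightarrow> ?R")
proof
  assume L: ?L
  have "\<not> (a < k \<and> k < c) \<or> (a, b, c) = (i, k, j)"
    using L assms(2) noncrossingD[OF T, of i k a c] noncrossingD[OF T, of a c k j]
      noncrossingD[OF T, of i k b j] noncrossingD[OF T, of i b k j]
    unfolding triangle_def by (cases "a = i"; cases "c = j"; cases b k rule: linorder_cases) auto
  then show ?R using L by force
next
  show "?R \<Longrightarrow> ?L" using assms by (auto simp: triangle_def)
qed

section \<open>Edges of a triangulated polygon\<close>

lemma polygon_edges_iff:
  assumes "n \<ge> 3" "a < b"
  shows "{a, b} \<in> polygon_edges n \<longleftrightarrow> b < n \<and> (b = Suc a \<or> a = 0 \<and> Suc b = n)"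
proof
  assume "{a, b} \<in> polygon_edges n"
  then obtain i where i: "i < n" "{a, b} = {i, Suc i mod n}" by (auto simp: polygon_edges_def)
  show "b < n \<and> (b = Suc a \<or> a = 0 \<and> Suc b = n)"
  proof (cases "Suc i = n")
    case True
    then show ?thesis using i assms by (auto simp: doubleton_eq_iff)
  next
    case False
    then show ?thesis using i assms by (auto simp: doubleton_eq_iff)
  qed
next
  assume R: "b < n \<and> (b = Suc a \<or> a = 0 \<and> Suc b = n)"
  show "{a, b} \<in> polygon_edges n"
  proof (cases "b = Suc a")
    case True
    then show ?thesis using R by (auto simp: polygon_edges_def intro!: exI[of _ a])
  next
    case False
    then show ?thesis using R by (auto simp: polygon_edges_def insert_commute intro!: exI[of _ b])
  qed
qed

text \<open>
  Reading the outer face without the modulus: its only ascending dart is \<open>(0, n - 1)\<close>, its descending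
  darts are the polygon edges between consecutive numbers.
\<close>

lemma outer_face_eq:
  assumes "n \<ge> 3"
  shows "outer_face n = insert (0, n - 1) {(Suc i, i) | i. Suc i < n}"
proof -
  have *: "{i. i < n} = insert (n - 1) {i. Suc i < n}" using assms by auto
  have "outer_face n = (\<lambda>i. (Suc i mod n, i)) ` {i. i < n}" by (auto simp: outer_face_def)
  also have "\<dots> = insert (0, n - 1) {(Suc i, i) | i. Suc i < n}"
    unfolding * using assms by auto
  finally show ?thesis .
qed

locale triangulated_polygon =
  fixes n :: nat and T :: "nat set set"
  assumes n_ge_3: "n \<ge> 3" and triangulation: "triangulation n T"
begin

lemma polygon_subset: "polygon_edges n \<subseteq> T"
  using triangulation by (auto simp: triangulation_def)

lemma polygon_edge_ends: "e \<in> polygon_edges n \<Longrightarrow> \<exists>a b. a < b \<and> b < n \<and> e = {a, b}"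
proof -
  assume "e \<in> polygon_edges n"
  then obtain i where i: "i < n" "e = {i, Suc i mod n}" by (auto simp: polygon_edges_def)
  show ?thesis
  proof (cases "Suc i = n")
    case True
    then show ?thesis using i n_ge_3 by (intro exI[of _ 0] exI[of _ i]) auto
  next
    case False
    then show ?thesis using i by (intro exI[of _ i] exI[of _ "Suc i"]) auto
  qed
qed

lemma edge_ends: "e \<in> T \<Longrightarrow> \<exists>a b. a < b \<and> b < n \<and> e = {a, b}"
proof -
  assume "e \<in> T"
  then consider "e \<in> polygon_edges n" | "e \<in> diagonals n"
    using triangulation by (auto simp: triangulation_def)
  then show ?thesis
  proof cases
    case 1
    then show ?thesis by (rule polygon_edge_ends)
  next
    case 2
    then obtain i j where "i < n" "j < n" "i \<noteq> j" "e = {i, j}" by (auto simp: diagonals_def)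
    then show ?thesis by (metis insert_commute linorder_neqE_nat)
  qed
qed

lemma edge_less: "{a, b} \<in> T \<Longrightarrow> a < n \<and> b < n \<and> a \<noteq> b"
  using edge_ends[of "{a, b}"] by (auto simp: doubleton_eq_iff)

lemma noncrossing: "noncrossing T"
  unfolding noncrossing_def
proof (intro allI impI notI)
  fix a b c d
  assume less: "a < b" "b < c" "c < d" and T: "{a, c} \<in> T" "{b, d} \<in> T"
  obtain D where D: "\<forall>e\<in>D. \<forall>f\<in>D. \<not> crossing e f" "T = polygon_edges n \<union> D"
    using triangulation by (auto simp: triangulation_def)
  have "crossing {a, c} {b, d}" using less unfolding crossing_def by blast
  then have "{a, c} \<in> polygon_edges n \<or> {b, d} \<in> polygon_edges n"
    using D T by blast
  with less edge_less[OF T(2)] show False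
    using polygon_edges_iff[OF n_ge_3, of a c] polygon_edges_iff[OF n_ge_3, of b d] by auto
qed

lemma finite_T: "finite T"
proof (rule finite_subset)
  show "T \<subseteq> Pow {..<n}" using edge_ends by fastforce
qed simp

lemma card_polygon_edges: "card (polygon_edges n) = n"
proof -
  have "polygon_edges n = (\<lambda>i. {i, Suc i mod n}) ` {..<n}"
    by (auto simp: polygon_edges_def)
  moreover have "inj_on (\<lambda>i. {i, Suc i mod n}) {..<n}"
  proof (rule inj_onI)
    fix i j assume ij: "i \<in> {..<n}" "j \<in> {..<n}" "{i, Suc i mod n} = {j, Suc j mod n}"
    show "i = j"
    proof (rule ccontr)
      assume "i \<noteq> j"
      \<comment> \<open>Two equal edges with different first ends make \<open>i\<close> its own second successor modulo \<open>n\<close>.\<close>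
      with ij have "i = Suc j mod n" "j = Suc i mod n" by (auto simp: doubleton_eq_iff)
      then have "i = Suc (Suc i) mod n" by (simp add: mod_Suc_eq)
      then show False using ij n_ge_3 by (cases "Suc (Suc i) < n") (auto simp: mod_if split: if_splits)
    qed
  qed
  ultimately show ?thesis by (simp add: card_image)
qed

lemma card_T: "card T = 2 * n - 3"
proof -
  obtain D where D: "D \<subseteq> diagonals n" "card D = n - 3" "T = polygon_edges n \<union> D"
    using triangulation by (auto simp: triangulation_def)
  have "finite D" "finite (polygon_edges n)" using finite_T D(3) by auto
  moreover have "polygon_edges n \<inter> D = {}" using D(1) by (auto simp: diagonals_def)
  ultimately have "card T = n + (n - 3)" using D by (simp add: card_Un_disjoint card_polygon_edges)
  then show ?thesis using n_ge_3 by simp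
qed

text \<open>
  The number of diagonals enters here: \<open>n\<close> polygon edges and \<open>n - 3\<close> diagonals give
  \<open>2 n - 3 = 2 (n - 1) - 1\<close> chords inside \<open>[0, n - 1]\<close>.
\<close>

lemma saturated_polygon: "saturated T 0 (n - 1)"
proof -
  have "T = (\<lambda>(a, b). {a, b}) ` chords T 0 (n - 1)"
    using edge_ends by (fastforce simp: chords_def image_iff)
  moreover have "inj_on (\<lambda>(a, b). {a, b}) (chords T 0 (n - 1))"
    by (auto simp: inj_on_def chords_def doubleton_eq_iff)
  ultimately have "card T = card (chords T 0 (n - 1))" by (metis card_image)
  then show ?thesis using card_T n_ge_3 by (auto simp: saturated_def)
qed

lemma saturated_iff_edge: "a < b \<Longrightarrow> saturated T a b \<longleftrightarrow> {a, b} \<in> T"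
  using saturated_edge[OF noncrossing] saturated_chord[OF noncrossing saturated_polygon, of a b]
    edge_less[of a b] by (auto simp: chords_def)

section \<open>Faces\<close>

text \<open>
  The minimisation in \<open>face_step\<close>, restated without modular arithmetic: walking from \<open>u\<close> downwards, and
  from \<open>n - 1\<close> on after passing \<open>0\<close>, no neighbour of \<open>v\<close> is met before \<open>w\<close>.
\<close>

lemma face_step_eqI:
  assumes u: "u < n" and vw: "{v, w} \<in> T" "w \<noteq> u"
    and least: "\<And>x. x \<noteq> u \<Longrightarrow> x \<noteq> w \<Longrightarrow> {v, x} \<in> T \<Longrightarrow>
      (if w \<le> u then x < w \<or> u < x else u < x \<and> x < w)"
  shows "face_step n T (u, v) = (v, w)"
proof -
  define P where "P = (\<lambda>x. x \<noteq> u \<and> {v, x} \<in> T)"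
  let ?m = "\<lambda>x. (u + n - x) mod n"
  have m: "?m x = (if x \<le> u then u - x else u + n - x)" if "x < n" for x
  proof (cases "x \<le> u")
    case True
    then have "u + n - x = (u - x) + n" by simp
    then have "?m x = (u - x) mod n" by simp
    then show ?thesis using True u by simp
  qed (use u in simp)
  have "P w" using vw by (simp add: P_def)
  from arg_min_nat_lemma[of P, OF this, of ?m]
  have min: "P (arg_min ?m P)" "?m (arg_min ?m P) \<le> ?m w"
    using \<open>P w\<close> by auto
  have "arg_min ?m P = w"
  proof (rule ccontr)
    assume ne: "arg_min ?m P \<noteq> w"
    define x where "x = arg_min ?m P"
    have x: "x \<noteq> u" "{v, x} \<in> T" "?m x \<le> ?m w" using min by (auto simp: P_def x_def)
    from least[OF x(1) _ x(2)] ne x edge_less[OF x(2)] edge_less[OF vw(1)] u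
    show False by (auto simp: m x_def[symmetric] split: if_splits)
  qed
  then show ?thesis by (simp add: face_step_def P_def)
qed

text \<open>
  At each corner, a neighbour met before the next corner of the triangle would be the end of an edge
  that crosses the opposite side.
\<close>

lemma face_step_triangle:
  assumes "triangle T a b c"
  shows "face_step n T (a, b) = (b, c)" "face_step n T (b, c) = (c, a)"
    "face_step n T (c, a) = (a, b)"
proof -
  note t = assms[unfolded triangle_def]
  have ends: "a < n" "b < n" "c < n" using t edge_less by blast+
  have comm: "{x, y} \<in> T \<Longrightarrow> {y, x} \<in> T" for x y by (simp add: insert_commute)
  note nc = noncrossingD[OF noncrossing]
  show "face_step n T (a, b) = (b, c)"
  proof (rule face_step_eqI)
    fix x assume x: "x \<noteq> a" "x \<noteq> c" "{b, x} \<in> T"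
    then have "\<not> x < a" "\<not> c < x" using t nc[of x b a c] nc[of a c b x] comm by (auto simp: insert_commute)
    with x t show "if c \<le> a then x < c \<or> a < x else a < x \<and> x < c" by auto
  qed (use t ends in auto)
  show "face_step n T (b, c) = (c, a)"
  proof (rule face_step_eqI)
    fix x assume x: "x \<noteq> b" "x \<noteq> a" "{c, x} \<in> T"
    then have "\<not> (a < x \<and> x < b)" using t nc[of a b x c] by (auto simp: insert_commute)
    with x t show "if a \<le> b then x < a \<or> b < x else b < x \<and> x < a" by auto
  qed (use t ends in \<open>auto simp: insert_commute\<close>)
  show "face_step n T (c, a) = (a, b)"
  proof (rule face_step_eqI)
    fix x assume x: "x \<noteq> c" "x \<noteq> b" "{a, x} \<in> T"
    then have "\<not> (b < x \<and> x < c)" using t nc[of a x b c] by auto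
    with x t show "if b \<le> c then x < b \<or> c < x else c < x \<and> x < b" by auto
  qed (use t ends in auto)
qed

lemma orbit_triangle:
  assumes "triangle T a b c" "d \<in> {(a, b), (b, c), (c, a)}"
  shows "orbit (face_step n T) d = {(a, b), (b, c), (c, a)}"
proof -
  let ?F = "{(a, b), (b, c), (c, a)}" and ?f = "face_step n T"
  note s = face_step_triangle[OF assms(1)]
  have "?F = orbit ?f (a, b)"
  proof
    show "?F \<subseteq> orbit ?f (a, b)"
      using orbit.base[of ?f "(a, b)"] orbit.step[of "(b, c)" ?f "(a, b)"]
        orbit.step[of "(c, a)" ?f "(a, b)"] s by simp
    show "orbit ?f (a, b) \<subseteq> ?F"
    proof
      fix x assume "x \<in> orbit ?f (a, b)"
      then show "x \<in> ?F" by induction (use s in auto)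
    qed
  qed
  then have "cyclic_on ?f ?F" unfolding cyclic_on_def by blast
  then show ?thesis using assms(2) unfolding cyclic_on_alldef by blast
qed

lemma face_step_outer:
  "face_step n T (0, n - 1) = (n - 1, n - 2)"
  "Suc (Suc i) < n \<Longrightarrow> face_step n T (Suc (Suc i), Suc i) = (Suc i, i)"
  "face_step n T (Suc 0, 0) = (0, n - 1)"
proof -
  have side: "{Suc i, i} \<in> T" if "Suc i < n" for i
    using polygon_subset polygon_edges_iff[OF n_ge_3, of i "Suc i"] that by (auto simp: insert_commute)
  have root: "{0, n - 1} \<in> T"
    using polygon_subset polygon_edges_iff[OF n_ge_3, of 0 "n - 1"] n_ge_3 by auto
  show "face_step n T (0, n - 1) = (n - 1, n - 2)"
    by (rule face_step_eqI) (use side[of "n - 2"] n_ge_3 edge_less in \<open>fastforce simp: numeral_2_eq_2 Suc_diff_Suc\<close>)+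
  show "face_step n T (Suc (Suc i), Suc i) = (Suc i, i)" if "Suc (Suc i) < n"
    by (rule face_step_eqI) (use side[of i] that edge_less in fastforce)+
  show "face_step n T (Suc 0, 0) = (0, n - 1)"
    by (rule face_step_eqI) (use root n_ge_3 edge_less in fastforce)+
qed

text \<open>
  Starting from \<open>(0, n - 1)\<close>, the walk descends along \<open>(n - 1, n - 2), \<dots>, (1, 0)\<close> and returns.
\<close>

lemma orbit_outer:
  assumes "d \<in> outer_face n"
  shows "orbit (face_step n T) d = outer_face n"
proof -
  let ?f = "face_step n T"
  have "outer_face n = orbit ?f (0, n - 1)"
  proof
    have down: "(Suc i, i) \<in> orbit ?f (0, n - 1)" if "i \<le> n - 2" for i
      using that
    proof (induction rule: inc_induct)
      case base
      show ?case using orbit.base[of ?f "(0, n - 1)"] face_step_outer(1) n_ge_3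
        by (simp add: numeral_2_eq_2 Suc_diff_Suc)
    next
      case (step i)
      then show ?case using orbit.step[OF step.IH] face_step_outer(2)[of i] by simp
    qed
    moreover have "(0, n - 1) \<in> orbit ?f (0, n - 1)"
      using orbit.step[OF down[of 0]] face_step_outer(3) by simp
    ultimately show "outer_face n \<subseteq> orbit ?f (0, n - 1)"
      by (auto simp: outer_face_eq[OF n_ge_3])
    show "orbit ?f (0, n - 1) \<subseteq> outer_face n"
    proof
      fix x assume "x \<in> orbit ?f (0, n - 1)"
      then show "x \<in> outer_face n"
      proof induction
        case base
        show ?case using face_step_outer(1) n_ge_3 by (auto simp: outer_face_eq[OF n_ge_3])
      next
        case (step y)
        then consider "y = (0, n - 1)" | "y = (Suc 0, 0)" | i where "y = (Suc (Suc i), Suc i)" "Suc (Suc i) < n"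
          unfolding outer_face_eq[OF n_ge_3] by (auto, metis not0_implies_Suc)
        then show ?case by cases (use face_step_outer n_ge_3 in \<open>auto simp: outer_face_eq[OF n_ge_3]\<close>)
      qed
    qed
  qed
  moreover have "(0, n - 1) \<in> outer_face n" by (simp add: outer_face_eq[OF n_ge_3])
  ultimately have "cyclic_on ?f (outer_face n)" unfolding cyclic_on_def by blast
  then show ?thesis using assms unfolding cyclic_on_alldef by blast
qed

text \<open>
  A dart outside the outer face has a triangle to its left: an ascending dart \<open>(u, v)\<close> the one
  above \<open>{u, v}\<close>, a descending dart the one below. Conversely, the tracing of a triangle is not the outer
  face because it contains an ascending dart that does not start at \<open>0\<close>.
\<close>

lemma inner_faces_eq:
  "inner_faces n T = {{(a, b), (b, c), (c, a)} | a b c. triangle T a b c}"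
proof (intro equalityI subsetI)
  fix F assume "F \<in> inner_faces n T"
  then obtain u v where uv: "{u, v} \<in> T" "u \<noteq> v" and F: "F = orbit (face_step n T) (u, v)"
    and "F \<noteq> outer_face n"
    by (auto simp: inner_faces_def faces_def darts_def)
  then have not_outer: "(u, v) \<notin> outer_face n" using orbit_outer by blast
  have "\<exists>a b c. triangle T a b c \<and> (u, v) \<in> {(a, b), (b, c), (c, a)}"
  proof (cases "u < v")
    case True
    then have "(u, v) \<in> chords T 0 (n - 1)" "(u, v) \<noteq> (0, n - 1)"
      using uv not_outer edge_less[of u v] by (auto simp: chords_def outer_face_eq[OF n_ge_3])
    from triangle_above[OF noncrossing saturated_polygon this] show ?thesis by blast
  next
    case False
    then have "saturated T v u" "u \<noteq> Suc v"
      using uv not_outer edge_less[of u v] saturated_iff_edge[of v u]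
      by (auto simp: insert_commute outer_face_eq[OF n_ge_3])
    from triangle_below[OF noncrossing this] show ?thesis by blast
  qed
  then show "F \<in> {{(a, b), (b, c), (c, a)} | a b c. triangle T a b c}"
    using orbit_triangle F by blast
next
  fix F assume "F \<in> {{(a, b), (b, c), (c, a)} | a b c. triangle T a b c}"
  then obtain a b c where F: "F = {(a, b), (b, c), (c, a)}" and t: "triangle T a b c" by blast
  then have "F \<in> faces n T"
    using orbit_triangle[OF t, of "(a, b)"] by (auto simp: faces_def darts_def triangle_def)
  moreover have "(b, c) \<notin> outer_face n" using t by (auto simp: outer_face_eq[OF n_ge_3] triangle_def)
  ultimately show "F \<in> inner_faces n T" using F by (auto simp: inner_faces_def)
qed

text \<open>
  There are finitely many faces, so a vanishing cardinality does mean that no interior triangle exists.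
\<close>

lemma triangle_with_side:
  assumes "card (interior_triangles n T) = 0" "triangle T a b c"
  shows "b = Suc a \<or> c = Suc b \<or> (a, c) = (0, n - 1)"
proof -
  have "finite (darts T)"
    by (rule finite_subset[of _ "{..<n} \<times> {..<n}"]) (use edge_less in \<open>auto simp: darts_def\<close>)
  then have "finite (interior_triangles n T)"
    by (auto simp: interior_triangles_def inner_faces_def faces_def)
  with assms(1) have "interior_triangles n T = {}" by simp
  moreover have "{(a, b), (b, c), (c, a)} \<in> inner_faces n T"
    using assms(2) inner_faces_eq by blast
  ultimately have "{{a, b}, {b, c}, {a, c}} \<inter> polygon_edges n \<noteq> {}"
    by (auto simp: interior_triangles_def face_edges_def insert_commute)
  then show ?thesis
    using assms(2) edge_less[of b c] polygon_edges_iff[OF n_ge_3, of a b] polygon_edges_iff[OF n_ge_3, of b c]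
      polygon_edges_iff[OF n_ge_3, of a c] by (auto simp: triangle_def)
qed

text \<open>
  With two values available, three vertices that are not all equal contain exactly one equal pair.
\<close>

lemma satisfying_iff:
  assumes "\<sigma> \<in> states n"
  shows "satisfying n T \<sigma> \<longleftrightarrow> (\<forall>a b c. triangle T a b c \<longrightarrow> \<not> (\<sigma> a = \<sigma> b \<and> \<sigma> b = \<sigma> c))"
proof -
  have "card {e \<in> face_edges {(a, b), (b, c), (c, a)}. frustrates \<sigma> e} = 1
      \<longleftrightarrow> \<not> (\<sigma> a = \<sigma> b \<and> \<sigma> b = \<sigma> c)" if t: "triangle T a b c" for a b c
  proof -
    have less: "a < b" "b < c" and ends: "a < n" "b < n" "c < n"
      using t edge_less by (auto simp: triangle_def)
    have s: "\<sigma> a = 1 \<or> \<sigma> a = -1" "\<sigma> b = 1 \<or> \<sigma> b = -1" "\<sigma> c = 1 \<or> \<sigma> c = -1"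
      using assms ends by (auto simp: states_def PiE_iff)
    have fr: "frustrates \<sigma> {x, y} \<longleftrightarrow> \<sigma> x = \<sigma> y" if "x \<noteq> y" for x y
      using that by (auto simp: frustrates_def doubleton_eq_iff)
    have ne: "{a, b} \<noteq> {b, c}" "{a, b} \<noteq> {a, c}" "{b, c} \<noteq> {a, c}"
      using less by (auto simp: doubleton_eq_iff)
    have "{e \<in> face_edges {(a, b), (b, c), (c, a)}. frustrates \<sigma> e} =
        (if \<sigma> a = \<sigma> b then {{a, b}} else {}) \<union> (if \<sigma> b = \<sigma> c then {{b, c}} else {}) \<union>
        (if \<sigma> a = \<sigma> c then {{a, c}} else {})"
      using less fr[of a b] fr[of b c] fr[of a c] by (auto simp: face_edges_def insert_commute)
    then show ?thesis using s ne by auto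
  qed
  moreover have "card {(a, b), (b, c), (c, a)} = 3" if "triangle T a b c" for a b c
    using that by (auto simp: triangle_def)
  ultimately show ?thesis unfolding satisfying_def inner_faces_eq by blast
qed

end

section \<open>Counting states on an interval\<close>

text \<open>
  Admissibility is restricted to the triangles inside \<open>[i, j]\<close> so that it depends on the values
  there only.
\<close>

definition proper :: "nat set set \<Rightarrow> nat \<Rightarrow> nat \<Rightarrow> (nat \<Rightarrow> int) \<Rightarrow> bool" where
  "proper T i j \<sigma> \<longleftrightarrow>
     (\<forall>a b c. triangle T a b c \<and> i \<le> a \<and> c \<le> j \<longrightarrow> \<not> (\<sigma> a = \<sigma> b \<and> \<sigma> b = \<sigma> c))"

definition proper_states :: "nat set set \<Rightarrow> nat \<Rightarrow> nat \<Rightarrow> int \<Rightarrow> int \<Rightarrow> (nat \<Rightarrow> int) set" where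
  "proper_states T i j x y = {\<sigma> \<in> {i..j} \<rightarrow>\<^sub>E {1, -1}. \<sigma> i = x \<and> \<sigma> j = y \<and> proper T i j \<sigma>}"

lemma finite_proper_states [simp]: "finite (proper_states T i j x y)"
  by (rule finite_subset[of _ "{i..j} \<rightarrow>\<^sub>E {1, -1}"]) (auto simp: proper_states_def intro: finite_PiE)

lemma proper_cong:
  assumes "\<And>v. i \<le> v \<Longrightarrow> v \<le> j \<Longrightarrow> \<sigma> v = \<tau> v"
  shows "proper T i j \<sigma> \<longleftrightarrow> proper T i j \<tau>"
proof -
  have "\<sigma> a = \<tau> a \<and> \<sigma> b = \<tau> b \<and> \<sigma> c = \<tau> c" if "triangle T a b c \<and> i \<le> a \<and> c \<le> j" for a b c
    using that by (auto simp: triangle_def intro!: assms)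
  then show ?thesis unfolding proper_def by metis
qed

lemma proper_split:
  assumes "noncrossing T" "triangle T i k j"
  shows "proper T i j \<sigma> \<longleftrightarrow> \<not> (\<sigma> i = \<sigma> k \<and> \<sigma> k = \<sigma> j) \<and> proper T i k \<sigma> \<and> proper T k j \<sigma>"
  unfolding proper_def triangle_split[OF assms] by blast

text \<open>
  Once the value at the apex is fixed, the two parts are independent: cutting a state at \<open>k\<close> and
  gluing two states that agree at \<open>k\<close> are inverse to each other.
\<close>

lemma card_proper_states_apex:
  assumes T: "noncrossing T" and t: "triangle T i k j" and "\<not> (x = z \<and> z = y)"
  shows "card {\<sigma> \<in> proper_states T i j x y. \<sigma> k = z} =
    card (proper_states T i k x z) * card (proper_states T k j z y)"
proof -
  let ?cut = "\<lambda>\<sigma>. (restrict \<sigma> {i..k}, restrict \<sigma> {k..j})"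
  let ?glue = "\<lambda>(\<sigma>, \<tau>). \<lambda>v. if v \<le> k then \<sigma> v else \<tau> v"
  have k: "i < k" "k < j" using t by (auto simp: triangle_def)
  have glue: "?glue (\<sigma>, \<tau>) \<in> {\<sigma> \<in> proper_states T i j x y. \<sigma> k = z}
      \<and> ?cut (?glue (\<sigma>, \<tau>)) = (\<sigma>, \<tau>)"
    if s: "\<sigma> \<in> proper_states T i k x z" "\<tau> \<in> proper_states T k j z y" for \<sigma> \<tau>
  proof -
    let ?g = "?glue (\<sigma>, \<tau>)"
    have E: "\<sigma> \<in> {i..k} \<rightarrow>\<^sub>E {1, -1}" "\<tau> \<in> {k..j} \<rightarrow>\<^sub>E {1, -1}"
      and ends: "\<sigma> i = x" "\<sigma> k = z" "\<tau> k = z" "\<tau> j = y"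
      and pr: "proper T i k \<sigma>" "proper T k j \<tau>"
      using s by (auto simp: proper_states_def)
    have eq: "?g v = \<sigma> v" if "v \<le> k" for v using that by simp
    have eq': "?g v = \<tau> v" if "k \<le> v" for v using that ends by (cases "v = k") auto
    have "proper T i j ?g"
      unfolding proper_split[OF T t]
      using pr assms(3) ends k eq eq' proper_cong[of i k ?g \<sigma> T] proper_cong[of k j ?g \<tau> T]
      by simp
    moreover have "?g \<in> {i..j} \<rightarrow>\<^sub>E {1, -1}"
    proof (rule PiE_I)
      fix v assume "v \<in> {i..j}"
      then show "?g v \<in> {1, -1}" using E by (cases "v \<le> k") (auto simp: PiE_iff)
    next
      fix v assume v: "v \<notin> {i..j}"
      then show "?g v = undefined"
        using k PiE_arb[OF E(1), of v] PiE_arb[OF E(2), of v] by auto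
    qed
    moreover have "restrict ?g {i..k} = \<sigma>" "restrict ?g {k..j} = \<tau>"
      using ends PiE_arb[OF E(1)] PiE_arb[OF E(2)] by (auto simp: restrict_def fun_eq_iff)
    ultimately show ?thesis using ends k by (simp add: proper_states_def)
  qed
  have cut: "?cut \<sigma> \<in> proper_states T i k x z \<times> proper_states T k j z y \<and> ?glue (?cut \<sigma>) = \<sigma>"
    if s: "\<sigma> \<in> {\<sigma> \<in> proper_states T i j x y. \<sigma> k = z}" for \<sigma>
  proof -
    have E: "\<sigma> \<in> {i..j} \<rightarrow>\<^sub>E {1, -1}" and ends: "\<sigma> i = x" "\<sigma> k = z" "\<sigma> j = y"
      and pr: "proper T i k \<sigma>" "proper T k j \<sigma>"
      using s proper_split[OF T t, of \<sigma>] by (auto simp: proper_states_def)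
    have "proper T i k (restrict \<sigma> {i..k})" "proper T k j (restrict \<sigma> {k..j})"
      using pr proper_cong[of i k "restrict \<sigma> {i..k}" \<sigma> T]
        proper_cong[of k j "restrict \<sigma> {k..j}" \<sigma> T] by auto
    moreover have "restrict \<sigma> {i..k} \<in> {i..k} \<rightarrow>\<^sub>E {1, -1}" "restrict \<sigma> {k..j} \<in> {k..j} \<rightarrow>\<^sub>E {1, -1}"
      using E k by (auto simp: PiE_iff)
    moreover have "?glue (?cut \<sigma>) = \<sigma>"
      using k PiE_arb[OF E] by (auto simp: fun_eq_iff)
    ultimately show ?thesis using ends k by (simp add: proper_states_def)
  qed
  have "bij_betw ?cut {\<sigma> \<in> proper_states T i j x y. \<sigma> k = z}
      (proper_states T i k x z \<times> proper_states T k j z y)"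
    by (rule bij_betw_byWitness[where f' = ?glue]) (use glue cut in \<open>blast+\<close>)
  then show ?thesis by (simp add: bij_betw_same_card card_cartesian_product)
qed

lemma card_proper_states_split:
  assumes T: "noncrossing T" and t: "triangle T i k j"
  shows "card (proper_states T i j x y) = (\<Sum>z\<in>{1, -1}. if x = z \<and> z = y then 0 else
    card (proper_states T i k x z) * card (proper_states T k j z y))"
proof -
  have k: "i < k" "k < j" using t by (auto simp: triangle_def)
  let ?S = "\<lambda>z. {\<sigma> \<in> proper_states T i j x y. \<sigma> k = z}"
  have "proper_states T i j x y = (\<Union>z\<in>{1, -1}. ?S z)"
    using k by (auto simp: proper_states_def PiE_iff)
  also have "card \<dots> = (\<Sum>z\<in>{1, -1}. card (?S z))"
    by (rule card_UN_disjoint) auto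
  also have "\<dots> = (\<Sum>z\<in>{1, -1}. if x = z \<and> z = y then 0 else
      card (proper_states T i k x z) * card (proper_states T k j z y))"
  proof (rule sum.cong)
    fix z :: int
    have "?S z = {}" if "x = z \<and> z = y"
      using that proper_split[OF T t] by (auto simp: proper_states_def)
    then show "card (?S z) = (if x = z \<and> z = y then 0 else
        card (proper_states T i k x z) * card (proper_states T k j z y))"
      using card_proper_states_apex[OF T t] by simp
  qed simp
  finally show ?thesis .
qed

lemma card_proper_states_side:
  assumes "x \<in> {1, -1}" "y \<in> {1, -1}"
  shows "card (proper_states T i (Suc i) x y) = 1"
proof -
  have "proper T i (Suc i) \<sigma>" for \<sigma> by (auto simp: proper_def triangle_def)
  then have "proper_states T i (Suc i) x y = {\<lambda>v\<in>{i..Suc i}. if v = i then x else y}"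
    using assms by (auto simp: proper_states_def PiE_iff extensional_def fun_eq_iff le_Suc_eq)
  then show ?thesis by simp
qed

text \<open>
  If \<open>x = y\<close>, the apex must take the opposite value, so both parts have different ends. If \<open>x \<noteq> y\<close>, it
  may take either value, which makes the ends equal in one part and different in the other.
\<close>

lemma card_proper_states_glue:
  assumes "noncrossing T" "triangle T i k j"
    and left: "\<And>x y. x \<in> {1, -1} \<Longrightarrow> y \<in> {1, -1} \<Longrightarrow>
      card (proper_states T i k x y) = (if x = y then a else b)"
    and right: "\<And>x y. x \<in> {1, -1} \<Longrightarrow> y \<in> {1, -1} \<Longrightarrow>
      card (proper_states T k j x y) = (if x = y then c else d)"
    and xy: "x \<in> {1, -1}" "y \<in> {1, -1}"
  shows "card (proper_states T i j x y) = (if x = y then b * d else a * d + b * c)"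
proof -
  have "card (proper_states T i j x y) = (\<Sum>z\<in>{1, -1}. if x = z \<and> z = y then 0 else
      (if x = z then a else b) * (if z = y then c else d))"
    unfolding card_proper_states_split[OF assms(1,2)]
    by (rule sum.cong) (auto simp: left[OF xy(1)] right[OF _ xy(2)])
  also have "\<dots> = (if x = y then b * d else a * d + b * c)"
    using xy by (elim insertE emptyE; simp)
  finally show ?thesis .
qed

text \<open>
  The hypothesis on triangles says that each apex is next to one end of its interval. The part on
  that side has length \<open>1\<close> and contributes \<open>F\<^sub>1 = F\<^sub>2 = 1\<close>, so the recursion of
  \<open>card_proper_states_glue\<close> becomes that of the Fibonacci numbers.
\<close>

lemma card_proper_states:
  assumes T: "noncrossing T" and "saturated T i j"
    and "\<And>a b c. triangle T a b c \<Longrightarrow> i \<le> a \<Longrightarrow> c \<le> j \<Longrightarrow> b = Suc a \<or> c = Suc b"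
    and "x \<in> {1, -1}" "y \<in> {1, -1}"
  shows "card (proper_states T i j x y) = (if x = y then fib (j - i) else fib (Suc (j - i)))"
  using assms
proof (induction arbitrary: x y rule: saturated_induct)
  case (side i)
  then show ?case using card_proper_states_side by simp
next
  case (split i j k)
  have t: "triangle T i k j" using triangleI[OF T split.hyps(2,3,1)] .
  have k: "i < k" "k < j" using t by (auto simp: triangle_def)
  have left: "card (proper_states T i k x y) = (if x = y then fib (k - i) else fib (Suc (k - i)))"
    if "x \<in> {1, -1}" "y \<in> {1, -1}" for x y
    using split.IH(1)[OF _ that] split.prems(1) k by (meson le_trans less_imp_le)
  have right: "card (proper_states T k j x y) = (if x = y then fib (j - k) else fib (Suc (j - k)))"
    if "x \<in> {1, -1}" "y \<in> {1, -1}" for x y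
    using split.IH(2)[OF _ that] split.prems(1) k by (meson le_trans less_imp_le)
  have glue: "card (proper_states T i j x y) = (if x = y then fib (Suc (k - i)) * fib (Suc (j - k))
      else fib (k - i) * fib (Suc (j - k)) + fib (Suc (k - i)) * fib (j - k))"
    by (rule card_proper_states_glue[OF T t left right split.prems(2,3)])
  have "k = Suc i \<or> j = Suc k" using split.prems(1)[OF t] by simp
  then show ?case
  proof
    assume "k = Suc i"
    moreover define m where "m = j - k - 1"
    ultimately have m: "k - i = Suc 0" "j - k = Suc m" "j - i = Suc (Suc m)"
      using k by linarith+
    show ?thesis unfolding glue m by simp
  next
    assume "j = Suc k"
    moreover define m where "m = k - i - 1"
    ultimately have m: "j - k = Suc 0" "k - i = Suc m" "j - i = Suc (Suc m)"
      using k by linarith+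
    show ?thesis unfolding glue m by simp
  qed
qed

theorem theorem1:
  fixes n :: nat and T :: "nat set set"
  assumes "n \<ge> 3"
    and "triangulation n T"
    and "card (interior_triangles n T) = 0"
  shows "num_satisfying n T = 2 * fib (n + 1)"
proof -
  interpret triangulated_polygon n T
    using assms by unfold_locales
  have "n - 1 \<noteq> Suc 0" using n_ge_3 by simp
  then obtain k where t: "triangle T 0 k (n - 1)"
    by (rule triangle_below[OF noncrossing saturated_polygon])
  define p q where "p = k" and "q = n - 1 - k"
  have k: "0 < k" "k < n - 1" and pq: "p + q = n - 1"
    using t by (auto simp: triangle_def p_def q_def)
  have sat: "saturated T 0 k" "saturated T k (n - 1)"
    using t saturated_iff_edge by (auto simp: triangle_def)
  \<comment> \<open>Inside either part, the exceptional polygon edge \<open>{0, n - 1}\<close> cannot occur.\<close>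
  have side: "b = Suc a \<or> c = Suc b" if "triangle T a b c" "c \<le> k \<or> k \<le> a" for a b c
    using triangle_with_side[OF assms(3) that(1)] that(2) k by auto
  have left: "card (proper_states T 0 k x y) = (if x = y then fib p else fib (Suc p))"
    if "x \<in> {1, -1}" "y \<in> {1, -1}" for x y
    using card_proper_states[OF noncrossing sat(1) _ that] side by (simp add: p_def)
  have right: "card (proper_states T k (n - 1) x y) = (if x = y then fib q else fib (Suc q))"
    if "x \<in> {1, -1}" "y \<in> {1, -1}" for x y
    using card_proper_states[OF noncrossing sat(2) _ that] side by (simp add: q_def)
  let ?S = "proper_states T 0 (n - 1)"
  have count: "card (?S x y) = (if x = y then fib (Suc p) * fib (Suc q)
      else fib p * fib (Suc q) + fib (Suc p) * fib q)"
    if "x \<in> {1, -1}" "y \<in> {1, -1}" for x y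
    by (rule card_proper_states_glue[OF noncrossing t left right that])
  have "c \<le> n - 1" if "triangle T a b c" for a b c
    using that edge_less[of b c] by (auto simp: triangle_def)
  then have "proper T 0 (n - 1) \<sigma> \<longleftrightarrow> satisfying n T \<sigma>" if "\<sigma> \<in> states n" for \<sigma>
    unfolding proper_def satisfying_iff[OF that] by blast
  moreover have "states n = {0..n - 1} \<rightarrow>\<^sub>E {1, -1}"
  proof -
    have "{..<n} = {0..n - 1}" using n_ge_3 by auto
    then show ?thesis by (simp add: states_def)
  qed
  ultimately have "{\<sigma> \<in> states n. satisfying n T \<sigma>} =
      (\<Union>(x, y)\<in>{1, -1} \<times> {1, -1}. ?S x y)"
    by (auto simp: proper_states_def PiE_iff)
  moreover have disjoint: "?S x y \<inter> ?S x' y' = {}" if "(x, y) \<noteq> (x', y')" for x y x' y'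
    using that by (auto simp: proper_states_def)
  ultimately have "num_satisfying n T = card (\<Union>(x, y)\<in>{1, -1} \<times> {1, -1}. ?S x y)"
    by (simp add: num_satisfying_def)
  also have "\<dots> = (\<Sum>(x, y)\<in>{1, -1} \<times> {1, -1}. card (?S x y))"
    using disjoint by (subst card_UN_disjoint) (auto simp: split_beta)
  also have "\<dots> = (\<Sum>x\<in>{1, -1}. \<Sum>y\<in>{1, -1}. card (?S x y))"
    by (simp only: sum.cartesian_product)
  also have "\<dots> = 2 * (fib (Suc p) * fib (Suc q)
      + (fib p * fib (Suc q) + fib (Suc p) * fib q))"
    by (simp add: count del: One_nat_def)
  also have "\<dots> = 2 * fib (Suc (Suc p + q))"
    by (simp only: fib_add[of "Suc p" q] fib.simps(3)) (simp add: algebra_simps)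
  also have "Suc (Suc p + q) = n + 1" using pq n_ge_3 by simp
  finally show ?thesis .
qed

end
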